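(* Let $\|\cdot\|_*$ be a norm on $\mathbb R^D$, and for $r>0$ let $\bigodot(r)=\{x\in\mathbb R^D:\|x\|_*\le r\}$. Let $\mathbf K=\bigodot(1)$ and $\kappa=\lambda[\mathbf K]^{-1}\mathbf 1_{\mathbf K}$. Let $(s_0,b_0,b_1,s_1)\in\Theta$ with $s_0\le 2^{-D}$, let $\Upsilon$ be the corresponding RealLife Euclidean automaton with kernel $\kappa$, and let $R=\min\{\sqrt[D]{b_0},\frac12\}$. Let $\mathbf A\subset\mathbb R^D$ be a Borel set. If $0<r<R$, $\mathbf A\subseteq\bigodot(r)$, and $s_0\cdot\lambda[\mathbf K]\le\lambda[\mathbf A]$, then $\mathbf 1_{\mathbf A}$ is a still life, i.e. $\Upsilon(\mathbf 1_{\mathbf A})=\mathbf 1_{\mathbf A}$. In particular, if $0<r<R$ and $\bigodot(\sqrt[D]{s_0})\subseteq\mathbf A\subseteq\bigodot(r)$, then $\mathbf 1_{\mathbf A}$ is a still life.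
   Context: $\lambda$ is Lebesgue measure on $\mathbb R^D$. $\Theta=\{(s_0,b_0,b_1,s_1): 0<s_0\le b_0<b_1\le s_1\le 1\}$. For a nonnegative bounded compactly supported kernel $\kappa$ with integral $1$, $(\kappa*\mathbf a)(x)=\int\kappa(y)\mathbf a(x-y)\,d\lambda(y)$, and the RealLife Euclidean automaton acts on Borel functions $\mathbf a:\mathbb R^D\to\{0,1\}$ by $$\Upsilon(\mathbf a)(x)=\mathbf a(x)\mathbf 1_{[s_0,s_1]}(\kappa*\mathbf a(x))+(1-\mathbf a(x))\mathbf 1_{[b_0,b_1]}(\kappa*\mathbf a(x)).$$ *)

theory Defs
  imports "HOL-Analysis.Analysis"
begin

text \<open>
  A norm on a real vector space, as a function independent of the type-class norm (which on
  \<^typ>\<open>real ^ 'n\<close> is the Euclidean one).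
\<close>

definition is_norm :: "('a::real_vector \<Rightarrow> real) \<Rightarrow> bool" where
  "is_norm N \<longleftrightarrow>
     (\<forall>x. N x \<ge> 0) \<and>
     (\<forall>x. N x = 0 \<longleftrightarrow> x = 0) \<and>
     (\<forall>c x. N (c *\<^sub>R x) = \<bar>c\<bar> * N x) \<and>
     (\<forall>x y. N (x + y) \<le> N x + N y)"

definition norm_ball :: "('a \<Rightarrow> real) \<Rightarrow> real \<Rightarrow> 'a set" where
  "norm_ball N r = {x. N x \<le> r}"

definition Theta :: "(real \<times> real \<times> real \<times> real) set" where
  "Theta = {(s0, b0, b1, s1). 0 < s0 \<and> s0 \<le> b0 \<and> b0 < b1 \<and> b1 \<le> s1 \<and> s1 \<le> 1}"

definition kernel_convolution :: "('a::euclidean_space \<Rightarrow> real) \<Rightarrow> ('a \<Rightarrow> real) \<Rightarrow> 'a \<Rightarrow> real" where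
  "kernel_convolution \<kappa> a x = (LINT y|lebesgue. \<kappa> y * a (x - y))"

text \<open>Configurations: Borel functions into \<open>{0,1}\<close>, with 0 and 1 taken as reals.\<close>

definition configs :: "('a::euclidean_space \<Rightarrow> real) set" where
  "configs = {a \<in> borel_measurable borel. range a \<subseteq> {0, 1}}"

text \<open>
  The RealLife Euclidean automaton with kernel \<open>\<kappa>\<close>. The formula is meaningful for
  \<open>a \<in> configs\<close> and for \<open>\<kappa>\<close> nonnegative, bounded, compactly supported, of integral 1; HOL
  functions being total, it is written down for all arguments.
\<close>

definition RealLife ::
  "('a::euclidean_space \<Rightarrow> real) \<Rightarrow> real \<times> real \<times> real \<times> real \<Rightarrow> ('a \<Rightarrow> real) \<Rightarrow> 'a \<Rightarrow> real" where
  "RealLife \<kappa> = (\<lambda>(s0, b0, b1, s1) a x.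
     a x * indicator {s0..s1} (kernel_convolution \<kappa> a x)
     + (1 - a x) * indicator {b0..b1} (kernel_convolution \<kappa> a x))"

text \<open>Equality of configurations is pointwise everywhere, not merely almost everywhere.\<close>

definition still_life ::
  "(('a::euclidean_space \<Rightarrow> real) \<Rightarrow> 'a \<Rightarrow> real) \<Rightarrow> ('a \<Rightarrow> real) \<Rightarrow> bool" where
  "still_life \<Upsilon> a \<longleftrightarrow> a \<in> configs \<and> \<Upsilon> a = a"

end

theory Submission
  imports Defs
begin

text \<open>
  The value \<open>(\<kappa> * \<one>\<^sub>A) x\<close> is \<open>\<lambda>[A \<inter> (x - K)] / \<lambda>[K]\<close>. It is always at most
  \<open>\<lambda>[A] / \<lambda>[K] \<le> r\<^sup>D < b0\<close>, so nothing is born. For \<open>x \<in> A\<close> the inequality \<open>r < 1/2\<close> and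
  symmetry of the ball give \<open>x - A \<subseteq> K\<close>, so the value is exactly \<open>\<lambda>[A] / \<lambda>[K] \<ge> s0\<close> and every
  live cell survives.
\<close>

lemma is_norm_minus: "is_norm N \<Longrightarrow> N (- x) = N x"
  unfolding is_norm_def by (metis abs_1 abs_minus mult_1 scaleR_minus1_left)

lemma is_norm_diff_le: "is_norm N \<Longrightarrow> N (x - y) \<le> N x + N y"
  using is_norm_minus[of N y] unfolding is_norm_def by (metis uminus_add_conv_diff add.commute)

lemma is_norm_sum_le:
  assumes "is_norm N" "finite I"
  shows "N (\<Sum>i\<in>I. f i) \<le> (\<Sum>i\<in>I. N (f i))"
  using assms(2)
proof (induction I rule: finite_induct)
  case empty
  have "N 0 = 0" using assms(1) unfolding is_norm_def by blast
  then show ?case by simp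
next
  case (insert i I)
  have "N (f i + sum f I) \<le> N (f i) + N (sum f I)"
    using assms(1) by (simp add: is_norm_def)
  then show ?case using insert by simp
qed

text \<open>Expand \<open>x\<close> in the orthonormal basis and bound each coordinate by
  \<open>norm x\<close>. The summand \<open>1\<close> in the constant makes it visibly
  positive.\<close>

lemma is_norm_le_norm:
  fixes N :: "'a::euclidean_space \<Rightarrow> real"
  assumes "is_norm N"
  obtains C where "C > 0" "\<And>x. N x \<le> C * norm x"
proof
  let ?C = "(\<Sum>b\<in>Basis. N b) + 1"
  have nonneg: "N x \<ge> 0" for x using assms by (simp add: is_norm_def)
  show "?C > 0" by (simp add: sum_nonneg nonneg add_nonneg_pos)
  show "N x \<le> ?C * norm x" for x
  proof -
    have "N x = N (\<Sum>b\<in>Basis. (x \<bullet> b) *\<^sub>R b)" by (simp add: euclidean_representation)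
    also have "\<dots> \<le> (\<Sum>b\<in>Basis. N ((x \<bullet> b) *\<^sub>R b))" by (intro is_norm_sum_le assms) simp
    also have "\<dots> = (\<Sum>b\<in>Basis. \<bar>x \<bullet> b\<bar> * N b)" using assms by (simp add: is_norm_def)
    also have "\<dots> \<le> (\<Sum>b\<in>Basis. norm x * N b)"
      by (intro sum_mono mult_right_mono Basis_le_norm nonneg)
    also have "\<dots> = (\<Sum>b\<in>Basis. N b) * norm x" by (simp add: sum_distrib_left mult.commute)
    also have "\<dots> \<le> ?C * norm x" by (simp add: algebra_simps)
    finally show ?thesis .
  qed
qed

text \<open>By the triangle inequality \<open>N\<close> changes by at most \<open>N (x - y)\<close>,
  and the Euclidean upper bound turns this into a Lipschitz estimate.\<close>

lemma is_norm_continuous_on: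
  fixes N :: "'a::euclidean_space \<Rightarrow> real"
  assumes "is_norm N"
  shows "continuous_on S N"
proof -
  obtain C where C: "C > 0" "\<And>x. N x \<le> C * norm x" using is_norm_le_norm[OF assms] by blast
  have le: "N x \<le> N (x - y) + N y" for x y
    using assms unfolding is_norm_def by (metis diff_add_cancel)
  have "\<bar>N x - N y\<bar> \<le> C * dist x y" for x y
    using le[of x y] le[of y x] C(2)[of "x - y"] C(2)[of "y - x"]
    by (simp add: dist_norm norm_minus_commute)
  then have "C-lipschitz_on S N"
    using C(1) by (auto intro!: lipschitz_onI simp: dist_real_def)
  then show ?thesis by (rule lipschitz_on_continuous_on)
qed

text \<open>The other half of the equivalence of norms: \<open>c\<close> is the minimum of
  \<open>N\<close> on the Euclidean unit sphere, and homogeneity carries the bound to all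
  vectors.\<close>

lemma norm_le_is_norm:
  fixes N :: "'a::euclidean_space \<Rightarrow> real"
  assumes "is_norm N"
  obtains c where "c > 0" "\<And>x. c * norm x \<le> N x"
proof -
  \<comment> \<open>A basis vector shows that the sphere is nonempty, so that the minimum is
    attained.\<close>
  have "(SOME b. b \<in> Basis) \<in> (Basis :: 'a set)" by (rule SOME_Basis)
  then have "sphere (0::'a) 1 \<noteq> {}" by (metis empty_iff mem_sphere_0 norm_Basis)
  then obtain u where u: "norm u = 1" "\<And>x. norm x = 1 \<Longrightarrow> N u \<le> N x"
    using continuous_attains_inf[OF compact_sphere _ is_norm_continuous_on[OF assms], of 0 1]
    by auto
  have "u \<noteq> 0" using u(1) by auto
  then have "N u > 0" using assms unfolding is_norm_def by (metis less_eq_real_def)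
  moreover have "N u * norm x \<le> N x" for x
  proof (cases "x = 0")
    case True
    then show ?thesis using assms by (simp add: is_norm_def)
  next
    case False
    have "N u \<le> N ((1 / norm x) *\<^sub>R x)" using False by (intro u(2)) simp
    also have "\<dots> = N x / norm x" using assms by (simp add: is_norm_def)
    finally show ?thesis using False by (simp add: field_simps)
  qed
  ultimately show ?thesis using that by blast
qed

text \<open>The lower bound on \<open>N\<close> gives boundedness and continuity gives closedness.
  Compactness is what makes the balls measurable of finite measure.\<close>

lemma compact_norm_ball:
  fixes N :: "'a::euclidean_space \<Rightarrow> real"
  assumes "is_norm N"
  shows "compact (norm_ball N r)"
proof -
  obtain c where c: "c > 0" "\<And>x. c * norm x \<le> N x" using norm_le_is_norm[OF assms] by blast
  have "norm_ball N r \<subseteq> cball 0 (r / c)"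
  proof
    fix x assume "x \<in> norm_ball N r"
    then have "c * norm x \<le> r" using c(2)[of x] by (simp add: norm_ball_def)
    then show "x \<in> cball 0 (r / c)" using c(1) by (simp add: field_simps)
  qed
  moreover have "closed (norm_ball N r)" unfolding norm_ball_def
    by (intro closed_Collect_le is_norm_continuous_on assms continuous_on_const)
  ultimately show ?thesis
    using bounded_subset[OF bounded_cball] by (auto simp: compact_eq_bounded_closed)
qed

lemma lmeasurable_norm_ball:
  fixes N :: "'a::euclidean_space \<Rightarrow> real"
  shows "is_norm N \<Longrightarrow> norm_ball N r \<in> lmeasurable"
  by (intro lmeasurable_compact compact_norm_ball)

text \<open>By the upper bound on \<open>N\<close>, the ball contains a Euclidean ball of radius
  \<open>r / C\<close>. This justifies dividing by the measure of \<open>K\<close>.\<close>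

lemma measure_norm_ball_pos:
  fixes N :: "'a::euclidean_space \<Rightarrow> real"
  assumes "is_norm N" "r > 0"
  shows "measure lebesgue (norm_ball N r) > 0"
proof -
  obtain C where C: "C > 0" "\<And>x. N x \<le> C * norm x" using is_norm_le_norm[OF assms(1)] by blast
  have sub: "cball 0 (r / C) \<subseteq> norm_ball N r"
  proof
    fix x :: 'a assume "x \<in> cball 0 (r / C)"
    then have "C * norm x \<le> r" using C(1) by (simp add: field_simps)
    then show "x \<in> norm_ball N r" using C(2)[of x] by (simp add: norm_ball_def)
  qed
  have "0 < measure lebesgue (cball (0::'a) (r / C))"
    using content_cball_pos[of "r / C" "0::'a"] C(1) assms(2) by simp
  also have "\<dots> \<le> measure lebesgue (norm_ball N r)"
    by (intro measure_mono_fmeasurable sub lmeasurable_norm_ball assms(1)) auto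
  finally show ?thesis .
qed

text \<open>By homogeneity the ball is the unit ball dilated by \<open>r\<close>, and Lebesgue
  measure scales with the power \<open>DIM('a)\<close>.\<close>

lemma measure_norm_ball:
  fixes N :: "'a::euclidean_space \<Rightarrow> real"
  assumes "is_norm N" "r > 0"
  shows "measure lebesgue (norm_ball N r) = r ^ DIM('a) * measure lebesgue (norm_ball N 1)"
proof -
  \<comment> \<open>The zero translation puts the dilation into the form of
    \<open>measure_lebesgue_affine\<close>.\<close>
  have "norm_ball N r = (\<lambda>x. r *\<^sub>R x + 0) ` norm_ball N 1"
  proof (intro equalityI subsetI)
    fix x assume "x \<in> norm_ball N r"
    then have "(1 / r) *\<^sub>R x \<in> norm_ball N 1"
      using assms by (simp add: norm_ball_def is_norm_def)
    moreover have "x = r *\<^sub>R ((1 / r) *\<^sub>R x) + 0" using assms(2) by simp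
    ultimately show "x \<in> (\<lambda>x. r *\<^sub>R x + 0) ` norm_ball N 1" by blast
  next
    fix x assume "x \<in> (\<lambda>x. r *\<^sub>R x + 0) ` norm_ball N 1"
    then show "x \<in> norm_ball N r"
      using assms mult_left_mono[of _ 1 r] by (auto simp: norm_ball_def is_norm_def)
  qed
  then show ?thesis
    using measure_lebesgue_affine[of r 0 "norm_ball N 1"] assms(2) by (simp add: add.commute)
qed

text \<open>The map \<open>y \<mapsto> x - y\<close> is its own inverse, so the image of
  \<open>A\<close> is also a preimage and hence Borel. As an affine map with factor
  \<open>-1\<close> it preserves measure, so finiteness carries over.\<close>

lemma lmeasurable_reflected_translate:
  fixes A :: "'a::euclidean_space set"
  assumes "A \<in> sets borel" "A \<in> lmeasurable"
  shows "(\<lambda>y. x - y) ` A \<in> lmeasurable"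
proof -
  have "(\<lambda>y. x - y) -` A \<in> sets borel"
    using measurable_sets[OF _ assms(1), of "\<lambda>y. x - y" borel] by simp
  moreover have "(\<lambda>y. x - y) -` A = (\<lambda>y. x - y) ` A"
    by (force simp: image_iff)
  moreover have "emeasure lebesgue ((\<lambda>y. x - y) ` A) = emeasure lebesgue A"
    using emeasure_lebesgue_affine[of "-1" x A] by simp
  ultimately show ?thesis using assms(2) by (auto simp: fmeasurable_def)
qed

lemma measure_reflected_translate:
  fixes A :: "'a::euclidean_space set"
  shows "measure lebesgue ((\<lambda>y. x - y) ` A) = measure lebesgue A"
  using measure_lebesgue_affine[of "-1" x A] by simp

text \<open>Since \<open>x - y\<close> lies in \<open>A\<close> exactly when \<open>y\<close> lies
  in the reflected translate of \<open>A\<close>, the integrand is a constant times the indicator of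
  an intersection.\<close>

lemma kernel_convolution_indicator:
  fixes A K :: "'a::euclidean_space set"
  assumes "K \<in> lmeasurable"
  shows "kernel_convolution (\<lambda>x. inverse (measure lebesgue K) * indicator K x) (indicator A) x
         = measure lebesgue (K \<inter> (\<lambda>y. x - y) ` A) / measure lebesgue K"
proof -
  have "indicator A (x - y) = (indicator ((\<lambda>y. x - y) ` A) y :: real)" for y
    by (force simp: indicator_def image_iff)
  then have "(\<lambda>y. inverse (measure lebesgue K) * indicator K y * indicator A (x - y))
      = (\<lambda>y. inverse (measure lebesgue K) * indicator (K \<inter> (\<lambda>y. x - y) ` A) y)"
    by (simp add: fun_eq_iff indicator_inter_arith)
  then show ?thesis
    unfolding kernel_convolution_def by (simp add: field_simps)
qed

lemma still_life_of_measure_ge: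
  fixes N :: "'a::euclidean_space \<Rightarrow> real"
  assumes N: "is_norm N"
    and K: "K = norm_ball N 1"
    and Theta: "(s0, b0, b1, s1) \<in> Theta"
    and A: "A \<in> sets borel" "A \<subseteq> norm_ball N r"
    and r: "0 < r" "r < root DIM('a) b0" "r < 1 / 2"
    and ge: "s0 * measure lebesgue K \<le> measure lebesgue A"
  shows "still_life (RealLife (\<lambda>x. inverse (measure lebesgue K) * indicator K x) (s0, b0, b1, s1))
    (indicator A)"
proof -
  let ?\<mu> = "measure (lebesgue :: 'a measure)"
  let ?c = "kernel_convolution (\<lambda>x. inverse (?\<mu> K) * indicator K x) (indicator A)"
  let ?A = "\<lambda>x. (\<lambda>y. x - y) ` A"
  have Theta': "0 < s0" "s0 \<le> b0" "b0 < b1" "b1 \<le> s1" "s1 \<le> 1"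
    using Theta by (auto simp: Theta_def)
  have Kpos: "?\<mu> K > 0" unfolding K by (intro measure_norm_ball_pos N) simp
  have Kmeas: "K \<in> lmeasurable" unfolding K by (intro lmeasurable_norm_ball N)
  have Asets: "A \<in> sets lebesgue" using A(1) by simp
  \<comment> \<open>Finiteness matters: \<open>measure\<close> is \<open>0\<close> on sets of
    infinite measure, and monotonicity would fail there.\<close>
  have Ameas: "A \<in> lmeasurable"
    by (rule fmeasurableI2[OF lmeasurable_norm_ball[OF N] A(2) Asets])
  have "r ^ DIM('a) < root DIM('a) b0 ^ DIM('a)"
    using r by (intro power_strict_mono) auto
  also have "\<dots> = b0" using Theta' by (intro real_root_pow_pos2) auto
  finally have rb0: "r ^ DIM('a) < b0" .
  have "?\<mu> A \<le> ?\<mu> (norm_ball N r)"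
    by (intro measure_mono_fmeasurable A(2) Asets lmeasurable_norm_ball N)
  also have "\<dots> = r ^ DIM('a) * ?\<mu> K" unfolding K by (intro measure_norm_ball N r)
  also have "\<dots> < b0 * ?\<mu> K" using rb0 Kpos by simp
  finally have Ab0: "?\<mu> A / ?\<mu> K < b0" using Kpos by (simp add: field_simps)
  have c: "?c x = ?\<mu> (K \<inter> ?A x) / ?\<mu> K" for x
    by (rule kernel_convolution_indicator[OF Kmeas])
  have c_less: "?c x < b0" for x
  proof -
    have "?\<mu> (K \<inter> ?A x) \<le> ?\<mu> (?A x)"
      using Kmeas lmeasurable_reflected_translate[OF A(1) Ameas, of x]
      by (intro measure_mono_fmeasurable) (auto simp: fmeasurable_def)
    also have "\<dots> = ?\<mu> A" by (rule measure_reflected_translate)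
    finally have "?c x \<le> ?\<mu> A / ?\<mu> K" unfolding c using Kpos by (simp add: divide_right_mono)
    then show ?thesis using Ab0 by (rule le_less_trans)
  qed
  have c_ge: "s0 \<le> ?c x" if "x \<in> A" for x
  proof -
    \<comment> \<open>Both \<open>x\<close> and \<open>y\<close> lie in the ball of radius
      \<open>r\<close>, so \<open>x - y\<close> has norm at most \<open>2 * r < 1\<close>.\<close>
    have "?A x \<subseteq> K"
    proof
      fix z assume "z \<in> ?A x"
      then obtain y where y: "y \<in> A" "z = x - y" by auto
      have "N z \<le> N x + N y" unfolding y(2) by (rule is_norm_diff_le[OF N])
      also have "\<dots> \<le> r + r" using A(2) that y(1) by (intro add_mono) (auto simp: norm_ball_def)
      finally show "z \<in> K" using r(3) by (simp add: K norm_ball_def)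
    qed
    then have "?c x = ?\<mu> A / ?\<mu> K"
      by (simp only: c Int_absorb1 measure_reflected_translate)
    moreover have "s0 \<le> ?\<mu> A / ?\<mu> K" using ge Kpos by (simp add: field_simps)
    ultimately show ?thesis by (simp only:)
  qed
  have "indicator A \<in> (configs :: ('a \<Rightarrow> real) set)"
    using A(1) by (auto simp: configs_def indicator_def)
  \<comment> \<open>On \<open>A\<close> the convolution lies between \<open>s0\<close> and
    \<open>b0\<close>, and \<open>b0 < b1 \<le> s1\<close> puts it in the survival interval. Off
    \<open>A\<close> it is below \<open>b0\<close>, so the birth term vanishes.\<close>
  moreover have "RealLife (\<lambda>x. inverse (?\<mu> K) * indicator K x) (s0, b0, b1, s1) (indicator A) x
      = indicator A x" for x
    using c_less[of x] c_ge[of x] Theta' by (auto simp: RealLife_def indicator_def)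
  ultimately show ?thesis by (auto simp: still_life_def)
qed

theorem proposition3p4:
  fixes N :: "real ^ 'n \<Rightarrow> real"
    and K A :: "(real ^ 'n) set"
    and \<kappa> :: "real ^ 'n \<Rightarrow> real"
    and \<Upsilon> :: "(real ^ 'n \<Rightarrow> real) \<Rightarrow> real ^ 'n \<Rightarrow> real"
    and s0 b0 b1 s1 R :: real
  assumes "is_norm N"
    and "K = norm_ball N 1"
    and "\<kappa> = (\<lambda>x. inverse (measure lebesgue K) * indicator K x)"
    and "(s0, b0, b1, s1) \<in> Theta"
    and "s0 \<le> 1 / 2 ^ CARD('n)"
    and "\<Upsilon> = RealLife \<kappa> (s0, b0, b1, s1)"
    and "R = min (root CARD('n) b0) (1 / 2)"
    and "A \<in> sets borel"
  shows "(\<forall>r. 0 < r \<and> r < R \<and> A \<subseteq> norm_ball N r \<and> s0 * measure lebesgue K \<le> measure lebesgue A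
              \<longrightarrow> still_life \<Upsilon> (indicator A)) \<and>
         (\<forall>r. 0 < r \<and> r < R \<and> norm_ball N (root CARD('n) s0) \<subseteq> A \<and> A \<subseteq> norm_ball N r
              \<longrightarrow> still_life \<Upsilon> (indicator A))"
proof -
  have s0: "s0 > 0" using assms(4) by (simp add: Theta_def)
  have *: "still_life \<Upsilon> (indicator A)"
    if "0 < r" "r < R" "A \<subseteq> norm_ball N r" "s0 * measure lebesgue K \<le> measure lebesgue A" for r
    unfolding assms(3,6) using that assms(7)
    by (intro still_life_of_measure_ge[OF assms(1,2,4,8)]) auto
  \<comment> \<open>The second claim reduces to the first: by scaling, the inner ball has measure
    exactly \<open>s0\<close> times that of \<open>K\<close>. The outer ball keeps the measure of
    \<open>A\<close> finite.\<close>
  have "s0 * measure lebesgue K \<le> measure lebesgue A"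
    if "norm_ball N (root CARD('n) s0) \<subseteq> A" "A \<subseteq> norm_ball N r" for r
  proof -
    have "s0 * measure lebesgue K = measure lebesgue (norm_ball N (root CARD('n) s0))"
      using s0 by (simp add: assms(2) measure_norm_ball[OF assms(1), of "root CARD('n) s0"])
    also have "\<dots> \<le> measure lebesgue A"
      using that assms(8) lmeasurable_norm_ball[OF assms(1)]
      by (intro measure_mono_fmeasurable fmeasurableI2[OF _ that(2)]) auto
    finally show ?thesis .
  qed
  with * show ?thesis by blast
qed

end
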